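(* Let $G$ be a Hausdorff topological group which has a compact subset that generates $G$ as an abstract group. Then $\operatorname{asdim}(G)=0$ if and only if $G$ is compact.
   Context: Coarse structure: a coarse structure on a set $Y$ is a collection $\mathcal{E}$ of subsets of $Y\times Y$ (entourages) that contains the diagonal and is closed under subsets, finite unions, inverses $E^{-1}=\{(y,x) : (x,y)\in E\}$ and compositions $E_1\circ E_2=\{(x,z) : \exists y,\ (x,y)\in E_1,\ (y,z)\in E_2\}$. Group-compact coarse structure: for a Hausdorff topological group $G$, it is $\mathcal{E}_{\mathcal{C}(G)}=\{E\subset G\times G : E\subset G(K\times K) \text{ for some compact } K\subset G\}$, where $G(K\times K)=\{(ga,gb) : g\in G,\ a,b\in K\}$. Asymptotic dimension: for a coarse space $(Y,\mathcal{E})$ and an integer $n\ge 0$, $\operatorname{asdim}(Y,\mathcal{E})\le n$ means that for every $L\in\mathcal{E}$ there is a cover $\mathcal{U}=\mathcal{U}_0\cup\dots\cup\mathcal{U}_n$ of $Y$ such that each $\mathcal{U}_i$ is $L$-disjoint (for all $A\ne B$ in $\mathcal{U}_i$, $(A\times B)\cap L=\emptyset$) and $\mathcal{U}$ is uniformly bounded (there is $M\in\mathcal{E}$ with $A\times A\subset M$ for all $A\in\mathcal{U}$). $\operatorname{asdim}(Y,\mathcal{E})$ is the least such $n$, or $\infty$ if there is none. For a Hausdorff topological group $G$, $\operatorname{asdim}(G):=\operatorname{asdim}(G,\mathcal{E}_{\mathcal{C}(G)})$. *)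

theory Defs
  imports
    "HOL-Analysis.Analysis"
    "HOL-Algebra.Generated_Groups"
    "HOL-Library.Extended_Nat"
begin

locale topological_group = group G for G (structure) +
  fixes T :: "'a topology"
  assumes topspace_eq: "topspace T = carrier G"
    and continuous_mult: "continuous_map (prod_topology T T) T (\<lambda>(x, y). x \<otimes> y)"
    and continuous_inv: "continuous_map T T (\<lambda>x. inv x)"

definition coarse_structure :: "'a set \<Rightarrow> ('a \<times> 'a) set set \<Rightarrow> bool" where
  "coarse_structure Y \<E> \<longleftrightarrow>
     (\<forall>E\<in>\<E>. E \<subseteq> Y \<times> Y) \<and>
     Id_on Y \<in> \<E> \<and>
     (\<forall>E\<in>\<E>. \<forall>F. F \<subseteq> E \<longrightarrow> F \<in> \<E>) \<and>
     (\<forall>E\<in>\<E>. \<forall>F\<in>\<E>. E \<union> F \<in> \<E>) \<and>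
     (\<forall>E\<in>\<E>. E\<inverse> \<in> \<E>) \<and>
     (\<forall>E\<in>\<E>. \<forall>F\<in>\<E>. E O F \<in> \<E>)"

definition entourage_disjoint :: "('a \<times> 'a) set \<Rightarrow> 'a set set \<Rightarrow> bool" where
  "entourage_disjoint L \<U> \<longleftrightarrow> (\<forall>A\<in>\<U>. \<forall>B\<in>\<U>. A \<noteq> B \<longrightarrow> (A \<times> B) \<inter> L = {})"

definition uniformly_bounded :: "('a \<times> 'a) set set \<Rightarrow> 'a set set \<Rightarrow> bool" where
  "uniformly_bounded \<E> \<U> \<longleftrightarrow> (\<exists>M\<in>\<E>. \<forall>A\<in>\<U>. A \<times> A \<subseteq> M)"

definition asdim_le :: "'a set \<Rightarrow> ('a \<times> 'a) set set \<Rightarrow> nat \<Rightarrow> bool" where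
  "asdim_le Y \<E> n \<longleftrightarrow>
     (\<forall>L\<in>\<E>. \<exists>\<U> :: nat \<Rightarrow> 'a set set.
        \<Union> (\<Union>i\<le>n. \<U> i) = Y \<and>
        (\<forall>i\<le>n. entourage_disjoint L (\<U> i)) \<and>
        uniformly_bounded \<E> (\<Union>i\<le>n. \<U> i))"

definition asdim :: "'a set \<Rightarrow> ('a \<times> 'a) set set \<Rightarrow> enat" where
  "asdim Y \<E> = (if \<exists>n. asdim_le Y \<E> n then enat (LEAST n. asdim_le Y \<E> n) else \<infinity>)"

definition group_translates :: "('a, 'b) monoid_scheme \<Rightarrow> 'a set \<Rightarrow> ('a \<times> 'a) set" where
  "group_translates G K =
     {(g \<otimes>\<^bsub>G\<^esub> a, g \<otimes>\<^bsub>G\<^esub> b) | g a b. g \<in> carrier G \<and> a \<in> K \<and> b \<in> K}"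

definition group_compact_coarse ::
    "('a, 'b) monoid_scheme \<Rightarrow> 'a topology \<Rightarrow> ('a \<times> 'a) set set" where
  "group_compact_coarse G T = {E. \<exists>K. compactin T K \<and> E \<subseteq> group_translates G K}"

definition group_asdim :: "('a, 'b) monoid_scheme \<Rightarrow> 'a topology \<Rightarrow> enat" where
  "group_asdim G T = asdim (carrier G) (group_compact_coarse G T)"

context topological_group
begin

lemma compactin_subset_carrier: "compactin T K \<Longrightarrow> K \<subseteq> carrier G"
  using compactin_subset_topspace topspace_eq by blast

lemma compactin_mult:
  assumes "compactin T K" "compactin T L"
  shows "compactin T ((\<lambda>(x, y). x \<otimes> y) ` (K \<times> L))"
  using assms by (intro image_compactin[OF _ continuous_mult]) (simp add: compactin_Times)

lemma compactin_inv: "compactin T K \<Longrightarrow> compactin T ((\<lambda>x. inv x) ` K)"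
  by (rule image_compactin[OF _ continuous_inv])

lemma group_translates_mono: "K \<subseteq> L \<Longrightarrow> group_translates G K \<subseteq> group_translates G L"
  unfolding group_translates_def by blast

lemma group_translates_comp:
  assumes K: "K \<subseteq> carrier G" and L: "L \<subseteq> carrier G"
  defines "M \<equiv> (\<lambda>(x, y). x \<otimes> y) ` (K \<times> ((\<lambda>(x, y). x \<otimes> y) ` (((\<lambda>x. inv x) ` L) \<times> L)))"
  shows "group_translates G K O group_translates G L \<subseteq> group_translates G (K \<union> M)"
proof
  fix p assume "p \<in> group_translates G K O group_translates G L"
  then obtain g a b h c d where
    p: "p = (g \<otimes> a, h \<otimes> d)" and eq: "g \<otimes> b = h \<otimes> c"
    and in1: "g \<in> carrier G" "a \<in> K" "b \<in> K" and in2: "h \<in> carrier G" "c \<in> L" "d \<in> L"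
    unfolding group_translates_def by auto
  have car: "a \<in> carrier G" "b \<in> carrier G" "c \<in> carrier G" "d \<in> carrier G"
    using in1 in2 K L by auto
  have "h = g \<otimes> b \<otimes> inv c"
    using eq car in1(1) in2(1) by (metis inv_solve_right m_closed)
  then have "h \<otimes> d = g \<otimes> (b \<otimes> (inv c \<otimes> d))"
    using car in1(1) in2(1) by (simp add: m_assoc)
  moreover have "b \<otimes> (inv c \<otimes> d) \<in> M"
    unfolding M_def using in1 in2
    by (intro image_eqI[of _ _ "(b, inv c \<otimes> d)"] SigmaI image_eqI[of _ _ "(inv c, d)"]) auto
  ultimately show "p \<in> group_translates G (K \<union> M)"
    unfolding group_translates_def p using in1 by blast
qed

lemma coarse_structure_group_compact_coarse:
  "coarse_structure (carrier G) (group_compact_coarse G T)"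
  unfolding coarse_structure_def
proof (intro conjI ballI allI impI)
  fix E assume "E \<in> group_compact_coarse G T"
  then show "E \<subseteq> carrier G \<times> carrier G"
    unfolding group_compact_coarse_def group_translates_def
    by (auto dest!: compactin_subset_carrier)
next
  have "Id_on (carrier G) \<subseteq> group_translates G {\<one>}"
  proof
    fix p assume "p \<in> Id_on (carrier G)"
    then obtain x where "x \<in> carrier G" "p = (x \<otimes> \<one>, x \<otimes> \<one>)"
      by (metis Id_onE r_one)
    then show "p \<in> group_translates G {\<one>}"
      unfolding group_translates_def by blast
  qed
  moreover have "compactin T {\<one>}"
    by (simp add: topspace_eq)
  ultimately show "Id_on (carrier G) \<in> group_compact_coarse G T"
    unfolding group_compact_coarse_def by blast
next
  fix E F :: "('a \<times> 'a) set" assume "E \<in> group_compact_coarse G T" "F \<subseteq> E"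
  then show "F \<in> group_compact_coarse G T"
    unfolding group_compact_coarse_def by blast
next
  fix E F assume "E \<in> group_compact_coarse G T" "F \<in> group_compact_coarse G T"
  then obtain K L where "compactin T K" "compactin T L"
    "E \<subseteq> group_translates G K" "F \<subseteq> group_translates G L"
    unfolding group_compact_coarse_def by blast
  moreover from this have "E \<union> F \<subseteq> group_translates G (K \<union> L)"
    using group_translates_mono[of K "K \<union> L"] group_translates_mono[of L "K \<union> L"] by blast
  moreover from calculation have "compactin T (K \<union> L)"
    by (intro compactin_Un)
  ultimately show "E \<union> F \<in> group_compact_coarse G T"
    unfolding group_compact_coarse_def by blast
next
  fix E assume "E \<in> group_compact_coarse G T"
  then obtain K where K: "compactin T K" "E \<subseteq> group_translates G K"
    unfolding group_compact_coarse_def by blast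
  have "(group_translates G K)\<inverse> \<subseteq> group_translates G K"
    unfolding group_translates_def by blast
  then show "E\<inverse> \<in> group_compact_coarse G T"
    unfolding group_compact_coarse_def using K by blast
next
  fix E F assume "E \<in> group_compact_coarse G T" "F \<in> group_compact_coarse G T"
  then obtain K L where K: "compactin T K" "E \<subseteq> group_translates G K"
    and L: "compactin T L" "F \<subseteq> group_translates G L"
    unfolding group_compact_coarse_def by blast
  let ?M = "(\<lambda>(x, y). x \<otimes> y) ` (K \<times> ((\<lambda>(x, y). x \<otimes> y) ` (((\<lambda>x. inv x) ` L) \<times> L)))"
  have "E O F \<subseteq> group_translates G K O group_translates G L"
    using K L by blast
  also have "\<dots> \<subseteq> group_translates G (K \<union> ?M)"
    using K L by (intro group_translates_comp compactin_subset_carrier)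
  finally have "E O F \<subseteq> group_translates G (K \<union> ?M)" .
  moreover have "compactin T (K \<union> ?M)"
    using K L by (intro compactin_Un compactin_mult compactin_inv)
  ultimately show "E O F \<in> group_compact_coarse G T"
    unfolding group_compact_coarse_def by blast
qed

end

end

theory Submission
  imports Defs
begin

text \<open>
  Suppose that the asymptotic dimension is zero and let \<open>K\<close> be a compact generating set. A cover
  by uniformly bounded sets that is disjoint with respect to the translates of \<open>K \<union> {\<one>}\<close>
  consists of sets that are closed under right multiplication by elements of \<open>K\<close> and their
  inverses. The member containing \<open>\<one>\<close> is then all of \<open>G\<close>, so \<open>G\<close> is bounded, that is,
  \<open>G = M\<inverse> M\<close> for some compact \<open>M\<close>.
\<close>

text \<open>The value \<open>\<infinity>\<close> excludes the case without any bound, and a least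
  natural number with a property has that property.\<close>

lemma asdim_eq_0_iff: "asdim Y \<E> = 0 \<longleftrightarrow> asdim_le Y \<E> 0"
proof
  assume "asdim Y \<E> = 0"
  then have "\<exists>n. asdim_le Y \<E> n" "(LEAST n. asdim_le Y \<E> n) = 0"
    by (auto simp: asdim_def zero_enat_def split: if_splits)
  then show "asdim_le Y \<E> 0"
    by (metis LeastI_ex)
next
  assume "asdim_le Y \<E> 0"
  then show "asdim Y \<E> = 0"
    by (auto simp: asdim_def zero_enat_def)
qed

context topological_group
begin

lemma group_translates_right_mult:
  assumes "g \<in> carrier G" "\<one> \<in> K" "k \<in> K"
  shows "(g, g \<otimes> k) \<in> group_translates G K" "(g \<otimes> k, g) \<in> group_translates G K"
proof -
  have "(g \<otimes> \<one>, g \<otimes> k) \<in> group_translates G K" "(g \<otimes> k, g \<otimes> \<one>) \<in> group_translates G K"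
    unfolding group_translates_def using assms by blast+
  then show "(g, g \<otimes> k) \<in> group_translates G K" "(g \<otimes> k, g) \<in> group_translates G K"
    using assms(1) by simp_all
qed

text \<open>If \<open>x\<close> in \<open>A\<close> is related to \<open>y\<close>, any cover member
  containing \<open>y\<close> must equal \<open>A\<close> by disjointness. Adjoining
  \<open>\<one>\<close> to \<open>K\<close> relates \<open>g\<close> and
  \<open>g \<otimes> k\<close> in both orders, so moving along generators never leaves
  \<open>A\<close>.\<close>

lemma entourage_disjoint_cover_generate_closed:
  assumes K: "K \<subseteq> carrier G"
    and disj: "entourage_disjoint (group_translates G (insert \<one> K)) \<U>"
    and cover: "\<Union> \<U> = carrier G"
    and A: "A \<in> \<U>"
    and h: "h \<in> generate G K"
    and g: "g \<in> A"
  shows "g \<otimes> h \<in> A"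
proof -
  have sub: "A \<subseteq> carrier G"
    using A cover by blast
  have step: "y \<in> A"
    if xy: "x \<in> A" "y \<in> carrier G" "(x, y) \<in> group_translates G (insert \<one> K)" for x y
  proof -
    obtain B where "B \<in> \<U>" "y \<in> B"
      using cover xy(2) by blast
    then show ?thesis
      using disj A xy unfolding entourage_disjoint_def by blast
  qed
  show ?thesis
    using h g
  proof (induction arbitrary: g rule: generate.induct)
    case one
    then show ?case
      using sub by auto
  next
    case (incl k)
    then have "g \<in> carrier G" "k \<in> carrier G"
      using K sub by auto
    with incl show ?case
      using group_translates_right_mult(1)[of g "insert \<one> K" k]
      by (auto intro!: step[OF incl.prems])
  next
    case (inv k)
    then have car: "g \<in> carrier G" "k \<in> carrier G"
      using K sub by auto
    \<comment> \<open>Multiplying by \<open>inv k\<close> undoes a multiplication by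
      \<open>k\<close>: the pair \<open>(g, g \<otimes> inv k)\<close> has the form
      \<open>(x \<otimes> k, x)\<close> with \<open>x = g \<otimes> inv k\<close>.\<close>
    then have "g \<otimes> inv k \<otimes> k = g"
      by (simp add: m_assoc)
    with inv car show ?case
      using group_translates_right_mult(2)[of "g \<otimes> inv k" "insert \<one> K" k]
      by (auto intro!: step[OF inv.prems])
  next
    case (eng h1 h2)
    have "h1 \<in> carrier G" "h2 \<in> carrier G" "g \<in> carrier G"
      using eng generate_in_carrier[OF K] sub by auto
    \<comment> \<open>After reassociation, the hypothesis for \<open>h2\<close> is applied at the
      point \<open>g \<otimes> h1\<close>; this is why \<open>g\<close> is generalized in the
      induction.\<close>
    with eng show ?case
      by (simp flip: m_assoc)
  qed
qed

text \<open>Fixing the first coordinate at \<open>\<one>\<close> determines the translating element: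
  \<open>\<one> = g \<otimes> a\<close> forces \<open>g = inv a\<close>. Hence every
  \<open>x\<close> is \<open>inv a \<otimes> b\<close> with \<open>a\<close>, \<open>b\<close> in
  \<open>M\<close>, and these products form a compact set.\<close>

lemma compact_space_if_carrier_bounded:
  assumes "carrier G \<times> carrier G \<in> group_compact_coarse G T"
  shows "compact_space T"
proof -
  obtain M where M: "compactin T M" "carrier G \<times> carrier G \<subseteq> group_translates G M"
    using assms unfolding group_compact_coarse_def by blast
  let ?N = "(\<lambda>(x, y). x \<otimes> y) ` (((\<lambda>x. inv x) ` M) \<times> M)"
  have N: "compactin T ?N"
    using M by (intro compactin_mult compactin_inv)
  have "carrier G \<subseteq> ?N"
  proof
    fix x assume x: "x \<in> carrier G"
    then have "(\<one>, x) \<in> group_translates G M"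
      using M by blast
    then obtain g a b where gab: "\<one> = g \<otimes> a" "x = g \<otimes> b" "g \<in> carrier G" "a \<in> M" "b \<in> M"
      unfolding group_translates_def by blast
    then have "g = inv a"
      using compactin_subset_carrier[OF M(1)] by (metis inv_equality subsetD)
    with gab show "x \<in> ?N"
      by (intro image_eqI[of _ _ "(inv a, b)"]) auto
  qed
  then have "?N = topspace T"
    using compactin_subset_carrier[OF N] topspace_eq by blast
  with N show ?thesis
    by (simp add: compact_space_def)
qed

lemma carrier_bounded_if_compact_space:
  assumes "compact_space T"
  shows "carrier G \<times> carrier G \<in> group_compact_coarse G T"
proof -
  have "carrier G \<times> carrier G \<subseteq> group_translates G (carrier G)"
  proof clarify
    fix a b assume ab: "a \<in> carrier G" "b \<in> carrier G"
    then have "(\<one> \<otimes> a, \<one> \<otimes> b) \<in> group_translates G (carrier G)"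
      unfolding group_translates_def by blast
    with ab show "(a, b) \<in> group_translates G (carrier G)"
      by simp
  qed
  then show ?thesis
    using assms topspace_eq unfolding group_compact_coarse_def compact_space_def by auto
qed

text \<open>The cover whose only member is the whole group is disjoint for every entourage,
  vacuously, and is bounded because the group itself is compact.\<close>

lemma asdim_le_0_if_compact_space:
  assumes "compact_space T"
  shows "asdim_le (carrier G) (group_compact_coarse G T) 0"
  unfolding asdim_le_def entourage_disjoint_def uniformly_bounded_def
  using carrier_bounded_if_compact_space[OF assms]
  by (intro ballI exI[of _ "\<lambda>_. {carrier G}"]) auto

lemma compact_space_if_asdim_le_0:
  assumes K: "compactin T K" "generate G K = carrier G"
    and "asdim_le (carrier G) (group_compact_coarse G T) 0"
  shows "compact_space T"
proof -
  have "compactin T (insert \<one> K)"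
    using compactin_Un[of T "{\<one>}" K] K by (simp add: topspace_eq)
  then have L: "group_translates G (insert \<one> K) \<in> group_compact_coarse G T"
    unfolding group_compact_coarse_def by blast
  obtain \<V> :: "nat \<Rightarrow> 'a set set" where \<V>: "\<Union> (\<Union>i\<le>0. \<V> i) = carrier G"
    "\<forall>i\<le>0. entourage_disjoint (group_translates G (insert \<one> K)) (\<V> i)"
    "uniformly_bounded (group_compact_coarse G T) (\<Union>i\<le>0. \<V> i)"
    using bspec[OF assms(3)[unfolded asdim_le_def] L] by (elim exE conjE)
  \<comment> \<open>In dimension 0 the index set \<open>i \<le> 0\<close> leaves a single family, so
    this one family covers the group and is disjoint.\<close>
  define \<U> where "\<U> = \<V> 0"
  have cover: "\<Union> \<U> = carrier G"
    and disj: "entourage_disjoint (group_translates G (insert \<one> K)) \<U>"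
    and "uniformly_bounded (group_compact_coarse G T) \<U>"
    using \<V> by (simp_all add: \<U>_def)
  then obtain M where M: "M \<in> group_compact_coarse G T" "\<And>A. A \<in> \<U> \<Longrightarrow> A \<times> A \<subseteq> M"
    unfolding uniformly_bounded_def by blast
  obtain A where A: "A \<in> \<U>" "\<one> \<in> A"
    using cover one_closed by blast
  \<comment> \<open>Start at \<open>\<one>\<close>, which lies in \<open>A\<close>: every
    \<open>h\<close> is generated by \<open>K\<close>, and
    \<open>\<one> \<otimes> h = h\<close>.\<close>
  have "carrier G \<subseteq> A"
  proof
    fix h assume "h \<in> carrier G"
    then show "h \<in> A"
      using entourage_disjoint_cover_generate_closed
        [OF compactin_subset_carrier[OF K(1)] disj cover A(1) _ A(2), of h] K(2)
      by simp
  qed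
  then have "carrier G \<times> carrier G \<subseteq> M"
    using M(2)[OF A(1)] by blast
  then have "carrier G \<times> carrier G \<in> group_compact_coarse G T"
    using M(1) unfolding group_compact_coarse_def by blast
  then show ?thesis
    by (rule compact_space_if_carrier_bounded)
qed

end

theorem corollary3p8:
  fixes G :: "('a, 'b) monoid_scheme" and T :: "'a topology"
  assumes "topological_group G T"
    and "Hausdorff_space T"
    and "\<exists>K. compactin T K \<and> generate G K = carrier G"
  shows "group_asdim G T = 0 \<longleftrightarrow> compact_space T"
  using topological_group.compact_space_if_asdim_le_0[OF assms(1)]
    topological_group.asdim_le_0_if_compact_space[OF assms(1)] assms(3)
  unfolding group_asdim_def asdim_eq_0_iff by blast

end
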